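(* Let $A$ be a uniform algebra on a compact Hausdorff space $\Omega$, and let $f$ be a strictly positive continuous function on $\Omega$. The following conditions are equivalent: 1. $A$ and $Af$ are almost $A$-isometric; 2. $A$ and $Af$ are almost isometric. Moreover, if $\Omega$ is equal to the Shilov boundary $\partial A$ of $A$, conditions 1 and 2 are also equivalent to: 3. $f\in \overline{Q}^{+}$.
   Context: A uniform algebra on a compact Hausdorff space $\Omega$ is a closed subalgebra of $C(\Omega)$ (complex continuous functions, sup norm) which contains the constants and separates points. $A^{-1}$ is the set of invertible elements of $A$. $Af=\{af: a\in A\}\subset C(\Omega)$ with the sup norm, an $A$-module under multiplication. Two Banach spaces $X,Y$ are almost isometric if for every $\epsilon>0$ there is a surjective linear isomorphism $T:X\to Y$ with $\|T\|\,\|T^{-1}\|<1+\epsilon$; two Banach $A$-modules are almost $A$-isometric if moreover $T$ can always be taken to be an $A$-module map. $Q=\{|g| : g\in A^{-1}\}\subset C(\Omega)$, $\overline{Q}$ is its uniform closure in $C(\Omega)$, and $\overline{Q}^{+}$ is the set of strictly positive functions in $\overline{Q}$. *)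

theory Defs
  imports "HOL-Analysis.Analysis"
begin

unbundle bcontfun.lifting

subsection \<open>The algebra \<open>C(\<Omega>)\<close>\<close>

text \<open>
  \<open>C(\<Omega>)\<close> is the library type of bounded continuous functions into the complex numbers, with its
  supremum norm; for compact \<open>\<Omega>\<close> boundedness is automatic. The library has the real normed space
  structure only, so the pointwise multiplication is added here. Complex scalars act through
  multiplication by constant functions.
\<close>

instantiation bcontfun :: (topological_space, real_normed_field) comm_ring_1
begin

lift_definition times_bcontfun :: "('a \<Rightarrow>\<^sub>C 'b) \<Rightarrow> ('a \<Rightarrow>\<^sub>C 'b) \<Rightarrow> ('a \<Rightarrow>\<^sub>C 'b)"
  is "\<lambda>f g x. f x * g x"
proof -
  fix f g :: "'a \<Rightarrow> 'b"
  assume "f \<in> bcontfun" "g \<in> bcontfun"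
  then obtain K L where "continuous_on UNIV f" "\<And>x. norm (f x) \<le> K"
      "continuous_on UNIV g" "\<And>x. norm (g x) \<le> L"
    by (auto simp: bcontfun_def bounded_iff)
  then show "(\<lambda>x. f x * g x) \<in> bcontfun"
    by (intro bcontfun_normI[where b = "K * L"] continuous_intros)
      (auto simp: norm_mult intro!: mult_mono intro: order_trans[OF norm_ge_zero])
qed

lift_definition one_bcontfun :: "'a \<Rightarrow>\<^sub>C 'b" is "\<lambda>_. 1"
  by (rule const_bcontfun)

lemmas [simp] = times_bcontfun.rep_eq one_bcontfun.rep_eq

instance
proof
  show "(0 :: 'a \<Rightarrow>\<^sub>C 'b) \<noteq> 1"
    by (metis one_bcontfun.rep_eq zero_bcontfun.rep_eq zero_neq_one)
qed (auto intro!: bcontfun_eqI simp: algebra_simps)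

end

lift_definition modulus :: "('a::topological_space \<Rightarrow>\<^sub>C complex) \<Rightarrow> ('a \<Rightarrow>\<^sub>C complex)"
  is "\<lambda>g x. complex_of_real (cmod (g x))"
  by (auto simp: bcontfun_def bounded_iff intro!: continuous_intros)

definition strictly_positive :: "('a::topological_space \<Rightarrow>\<^sub>C complex) \<Rightarrow> bool" where
  "strictly_positive f \<longleftrightarrow> (\<forall>x. apply_bcontfun f x \<in> \<real> \<and> 0 < Re (apply_bcontfun f x))"


subsection \<open>Uniform algebras\<close>

definition uniform_algebra :: "('a::topological_space \<Rightarrow>\<^sub>C complex) set \<Rightarrow> bool" where
  "uniform_algebra A \<longleftrightarrow>
     closed A \<and>
     (\<forall>a\<in>A. \<forall>b\<in>A. a + b \<in> A) \<and>
     (\<forall>c. \<forall>a\<in>A. const_bcontfun c * a \<in> A) \<and>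
     (\<forall>a\<in>A. \<forall>b\<in>A. a * b \<in> A) \<and>
     (\<forall>c. const_bcontfun c \<in> A) \<and>
     (\<forall>x y. x \<noteq> y \<longrightarrow> (\<exists>a\<in>A. apply_bcontfun a x \<noteq> apply_bcontfun a y))"

definition invertibles :: "('a::topological_space \<Rightarrow>\<^sub>C complex) set \<Rightarrow> ('a \<Rightarrow>\<^sub>C complex) set" where
  "invertibles A = {g \<in> A. \<exists>h\<in>A. g * h = 1}"

definition principal_module ::
    "('a::topological_space \<Rightarrow>\<^sub>C complex) set \<Rightarrow> ('a \<Rightarrow>\<^sub>C complex) \<Rightarrow> ('a \<Rightarrow>\<^sub>C complex) set" where
  "principal_module A f = {a * f | a. a \<in> A}"

definition Q_set :: "('a::topological_space \<Rightarrow>\<^sub>C complex) set \<Rightarrow> ('a \<Rightarrow>\<^sub>C complex) set" where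
  "Q_set A = {modulus g | g. g \<in> invertibles A}"

definition Q_closure_pos :: "('a::topological_space \<Rightarrow>\<^sub>C complex) set \<Rightarrow> ('a \<Rightarrow>\<^sub>C complex) set" where
  "Q_closure_pos A = {f \<in> closure (Q_set A). strictly_positive f}"

definition is_boundary :: "('a::topological_space \<Rightarrow>\<^sub>C complex) set \<Rightarrow> 'a set \<Rightarrow> bool" where
  "is_boundary A E \<longleftrightarrow> (\<forall>a\<in>A. \<exists>x\<in>E. cmod (apply_bcontfun a x) = norm a)"

text \<open>
  The Shilov boundary is the smallest closed boundary. It is viewed as a subset of \<open>\<Omega>\<close>, which
  embeds into the maximal ideal space by point evaluations.
\<close>

definition is_Shilov_boundary :: "('a::topological_space \<Rightarrow>\<^sub>C complex) set \<Rightarrow> 'a set \<Rightarrow> bool" where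
  "is_Shilov_boundary A S \<longleftrightarrow>
     closed S \<and> is_boundary A S \<and> (\<forall>E. closed E \<and> is_boundary A E \<longrightarrow> S \<subseteq> E)"


subsection \<open>Almost isometries\<close>

text \<open>
  Maps between subspaces of \<open>C(\<Omega>)\<close> are represented by functions on the whole type, of which only
  the values on the domain \<open>X\<close> matter.
\<close>

definition complex_linear_on ::
    "('a::topological_space \<Rightarrow>\<^sub>C complex) set \<Rightarrow> (('a \<Rightarrow>\<^sub>C complex) \<Rightarrow> ('b::topological_space \<Rightarrow>\<^sub>C complex)) \<Rightarrow> bool"
  where
  "complex_linear_on X T \<longleftrightarrow>
     (\<forall>x\<in>X. \<forall>y\<in>X. T (x + y) = T x + T y) \<and>
     (\<forall>c. \<forall>x\<in>X. T (const_bcontfun c * x) = const_bcontfun c * T x)"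

definition bounded_on ::
    "'v::real_normed_vector set \<Rightarrow> ('v \<Rightarrow> 'w::real_normed_vector) \<Rightarrow> bool" where
  "bounded_on X T \<longleftrightarrow> (\<exists>K. \<forall>x\<in>X. norm (T x) \<le> K * norm x)"

text \<open>
  The library's \<^const>\<open>onorm\<close>, relativised to a subspace. As there, the supremum is meaningful only
  for bounded maps, and the quotient at \<open>0\<close> is \<open>0\<close>.
\<close>

definition onorm_on ::
    "'v::real_normed_vector set \<Rightarrow> ('v \<Rightarrow> 'w::real_normed_vector) \<Rightarrow> real" where
  "onorm_on X T = (SUP x\<in>X. norm (T x) / norm x)"

definition linear_isomorphism ::
    "('a::topological_space \<Rightarrow>\<^sub>C complex) set \<Rightarrow> ('b::topological_space \<Rightarrow>\<^sub>C complex) set \<Rightarrow>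
      (('a \<Rightarrow>\<^sub>C complex) \<Rightarrow> ('b \<Rightarrow>\<^sub>C complex)) \<Rightarrow> bool" where
  "linear_isomorphism X Y T \<longleftrightarrow>
     complex_linear_on X T \<and> bij_betw T X Y \<and> bounded_on X T \<and> bounded_on Y (inv_into X T)"

definition almost_isometric ::
    "('a::topological_space \<Rightarrow>\<^sub>C complex) set \<Rightarrow> ('b::topological_space \<Rightarrow>\<^sub>C complex) set \<Rightarrow> bool" where
  "almost_isometric X Y \<longleftrightarrow>
     (\<forall>\<epsilon>>0. \<exists>T. linear_isomorphism X Y T \<and>
        onorm_on X T * onorm_on Y (inv_into X T) < 1 + \<epsilon>)"

definition module_map_on ::
    "('a::topological_space \<Rightarrow>\<^sub>C complex) set \<Rightarrow> ('a \<Rightarrow>\<^sub>C complex) set \<Rightarrow>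
      (('a \<Rightarrow>\<^sub>C complex) \<Rightarrow> ('a \<Rightarrow>\<^sub>C complex)) \<Rightarrow> bool" where
  "module_map_on A X T \<longleftrightarrow> (\<forall>a\<in>A. \<forall>x\<in>X. T (a * x) = a * T x)"

definition almost_module_isometric ::
    "('a::topological_space \<Rightarrow>\<^sub>C complex) set \<Rightarrow>
      ('a \<Rightarrow>\<^sub>C complex) set \<Rightarrow> ('a \<Rightarrow>\<^sub>C complex) set \<Rightarrow> bool" where
  "almost_module_isometric A X Y \<longleftrightarrow>
     (\<forall>\<epsilon>>0. \<exists>T. linear_isomorphism X Y T \<and> module_map_on A X T \<and>
        onorm_on X T * onorm_on Y (inv_into X T) < 1 + \<epsilon>)"

end

theory Submission
  imports Defs
begin

text \<open>
  Let \<open>T : A \<rightarrow> Af\<close> be a surjective contraction with \<open>\<parallel>T\<inverse>\<parallel> \<le> 1 + \<epsilon>\<close>. For \<open>y\<close> in the Shilov boundary, testing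
  \<open>T\<close> against functions that peak near \<open>y\<close> gives a point \<open>x\<close> with \<open>T b y \<approx> T 1 y \<cdot> b x\<close> for any
  prescribed finite set of \<open>b \<in> A\<close>. Hence \<open>\<bar>T 1\<bar> \<approx> 1\<close> and \<open>T 1 \<cdot> T (b\<^sup>2) \<approx> (T b)\<^sup>2\<close> on the Shilov boundary.
  Write \<open>T 1 = h f\<close> and choose \<open>b\<close> with \<open>T b = f\<close> and \<open>k\<close> with \<open>T (b\<^sup>2) = k f\<close>: the second relation becomes
  \<open>h k \<approx> 1\<close>, so \<open>h\<close> is invertible in \<open>A\<close>, and \<open>a \<mapsto> a h f\<close> is an almost isometric module isomorphism.
  If the Shilov boundary is all of \<open>\<Omega>\<close>, then \<open>\<bar>h f\<bar> \<approx> 1\<close> everywhere, so \<open>\<bar>h\<inverse>\<bar>\<close> approximates \<open>f\<close>; conversely,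
  \<open>\<bar>g\<bar> \<approx> f\<close> makes \<open>a \<mapsto> a g\<inverse> f\<close> almost isometric.
\<close>

subsection \<open>Functions on a compact space\<close>

lemma norm_mult_bcontfun_le:
  fixes f g :: "'a::topological_space \<Rightarrow>\<^sub>C 'b::real_normed_field"
  shows "norm (f * g) \<le> norm f * norm g"
  by (rule norm_bound) (auto simp: norm_mult intro!: mult_mono norm_bounded)

lemma apply_bcontfun_power [simp]:
  fixes f :: "'a::topological_space \<Rightarrow>\<^sub>C 'b::real_normed_field"
  shows "apply_bcontfun (f ^ n) x = apply_bcontfun f x ^ n"
  by (induction n) auto

lemma norm_power_bcontfun_le:
  fixes f :: "'a::topological_space \<Rightarrow>\<^sub>C 'b::real_normed_field"
  shows "norm (f ^ n) \<le> norm f ^ n"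
  by (rule norm_bound) (auto simp: norm_power intro!: power_mono norm_bounded)

text \<open>Constant functions act as the scalars, so this is homogeneity of the norm. The lower
  estimate comes from undoing the scaling with \<open>inverse c\<close>.\<close>

lemma norm_const_bcontfun_mult:
  fixes f :: "'a::topological_space \<Rightarrow>\<^sub>C 'b::real_normed_field"
  shows "norm (const_bcontfun c * f) = norm c * norm f"
proof (cases "c = 0")
  case False
  have "norm f = norm (const_bcontfun (inverse c) * (const_bcontfun c * f))"
    using False by (intro arg_cong[where f = norm] bcontfun_eqI) auto
  also have "\<dots> \<le> norm (inverse c) * norm (const_bcontfun c * f)"
    by (rule norm_bound) (auto simp: norm_mult simp del: times_bcontfun.rep_eq
        simp: times_bcontfun.rep_eq[of "const_bcontfun (inverse c)"] intro!: mult_left_mono norm_bounded)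
  finally have "norm c * norm f \<le> norm (const_bcontfun c * f)"
    using False by (simp only: norm_inverse) (simp add: field_simps)
  moreover have "norm (const_bcontfun c * f) \<le> norm c * norm f"
    by (rule norm_bound) (auto simp: norm_mult intro!: mult_left_mono norm_bounded)
  ultimately show ?thesis by simp
qed simp

lemma strictly_positive_nonzero: "strictly_positive f \<Longrightarrow> apply_bcontfun f x \<noteq> 0"
  unfolding strictly_positive_def by (metis less_irrefl zero_complex.sel(1))

lemma strictly_positive_eq_cmod:
  "strictly_positive f \<Longrightarrow> apply_bcontfun f x = of_real (cmod (apply_bcontfun f x))"
  unfolding strictly_positive_def by (auto simp: complex_is_Real_iff complex_eq_iff cmod_eq_Re less_imp_le)

lemma norm_bcontfun_attained:
  fixes f :: "'a::topological_space \<Rightarrow>\<^sub>C 'b::real_normed_vector"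
  assumes "compact (UNIV :: 'a set)"
  obtains x where "norm (apply_bcontfun f x) = norm f"
proof -
  have "continuous_on UNIV (\<lambda>x. norm (apply_bcontfun f x))"
    by (intro continuous_intros) auto
  with continuous_attains_sup[OF assms, of "\<lambda>x. norm (apply_bcontfun f x)"]
  obtain x where "\<And>y. norm (apply_bcontfun f y) \<le> norm (apply_bcontfun f x)"
    by auto
  then have "norm f \<le> norm (apply_bcontfun f x)" by (rule norm_bound)
  with norm_bounded[of f x] show thesis by (intro that[of x]) simp
qed

lemma bcontfun_bounded_below:
  fixes f :: "'a::topological_space \<Rightarrow>\<^sub>C 'b::real_normed_vector"
  assumes "compact (UNIV :: 'a set)" "\<And>x. apply_bcontfun f x \<noteq> 0"
  obtains m where "0 < m" "\<And>x. m \<le> norm (apply_bcontfun f x)"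
proof -
  have "continuous_on UNIV (\<lambda>x. norm (apply_bcontfun f x))"
    by (intro continuous_intros) auto
  with continuous_attains_inf[OF assms(1), of "\<lambda>x. norm (apply_bcontfun f x)"]
  obtain x where "\<And>y. norm (apply_bcontfun f x) \<le> norm (apply_bcontfun f y)"
    by auto
  with assms(2) show thesis by (intro that[of "norm (apply_bcontfun f x)"]) auto
qed

lemma bcontfun_inverse_exists:
  fixes f :: "'a::topological_space \<Rightarrow>\<^sub>C 'b::real_normed_field"
  assumes "compact (UNIV :: 'a set)" "\<And>x. apply_bcontfun f x \<noteq> 0"
  obtains g where "f * g = 1"
proof -
  have "continuous_on UNIV (\<lambda>x. inverse (apply_bcontfun f x))"
    using assms(2) by (intro continuous_intros) auto
  moreover from bcontfun_bounded_below[OF assms] obtain m where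
    m: "0 < m" "\<And>x. m \<le> norm (apply_bcontfun f x)" by blast
  have "norm (inverse (apply_bcontfun f x)) \<le> inverse m" for x
    using m by (simp add: norm_inverse le_imp_inverse_le)
  ultimately have "(\<lambda>x. inverse (apply_bcontfun f x)) \<in> bcontfun"
    by (rule bcontfun_normI)
  then obtain g where "(\<lambda>x. inverse (apply_bcontfun f x)) = apply_bcontfun g"
    by (rule bcontfunE)
  then have "apply_bcontfun g x = inverse (apply_bcontfun f x)" for x
    by metis
  with assms(2) have "f * g = 1" by (intro bcontfun_eqI) simp
  then show thesis by (rule that)
qed

text \<open>By compactness a strict pointwise bound leaves a gap below \<open>c\<close>. With
  \<open>c = 1\<close> this makes the powers of a scalar function decay uniformly on
  \<open>E\<close>.\<close>

lemma less_norm_imp_uniformly_less: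
  fixes f :: "'a::topological_space \<Rightarrow>\<^sub>C 'b::real_normed_vector"
  assumes "compact E" "\<And>x. x \<in> E \<Longrightarrow> norm (apply_bcontfun f x) < c" "0 < c"
  obtains r where "0 \<le> r" "r < c" "\<And>x. x \<in> E \<Longrightarrow> norm (apply_bcontfun f x) \<le> r"
proof (cases "E = {}")
  case False
  have "continuous_on E (\<lambda>x. norm (apply_bcontfun f x))"
    by (intro continuous_intros) auto
  from continuous_attains_sup[OF assms(1) False this]
  obtain x where "x \<in> E" "\<And>y. y \<in> E \<Longrightarrow> norm (apply_bcontfun f y) \<le> norm (apply_bcontfun f x)"
    by blast
  with assms(2) show thesis by (intro that[of "norm (apply_bcontfun f x)"]) auto
qed (use that[of 0] assms(3) in auto)

lemma exists_power_mult_less: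
  fixes r K c :: real
  assumes "0 \<le> r" "r < 1" "0 < c"
  obtains n where "r ^ n * K < c"
proof -
  have "(\<lambda>n. r ^ n * K) \<longlonglongrightarrow> 0"
    using assms by (intro tendsto_mult_left_zero LIMSEQ_realpow_zero)
  then have "\<forall>\<^sub>F n in sequentially. r ^ n * K < c"
    using assms(3) by (rule order_tendstoD)
  then show thesis using that by (auto simp: eventually_sequentially)
qed


subsection \<open>Uniform algebras\<close>

context
  fixes A :: "('a::topological_space \<Rightarrow>\<^sub>C complex) set"
  assumes ua: "uniform_algebra A"
begin

lemma uniform_algebra_add: "a \<in> A \<Longrightarrow> b \<in> A \<Longrightarrow> a + b \<in> A"
  and uniform_algebra_mult: "a \<in> A \<Longrightarrow> b \<in> A \<Longrightarrow> a * b \<in> A"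
  and uniform_algebra_const: "const_bcontfun c \<in> A"
  using ua unfolding uniform_algebra_def by blast+

lemma uniform_algebra_diff: "a \<in> A \<Longrightarrow> b \<in> A \<Longrightarrow> a - b \<in> A"
proof -
  assume "a \<in> A" "b \<in> A"
  then have "a + const_bcontfun (-1) * b \<in> A"
    by (intro uniform_algebra_add uniform_algebra_mult uniform_algebra_const)
  also have "a + const_bcontfun (-1) * b = a - b"
    by (rule bcontfun_eqI) simp
  finally show ?thesis .
qed

lemma uniform_algebra_one: "1 \<in> A"
proof -
  have "const_bcontfun 1 = (1 :: 'a \<Rightarrow>\<^sub>C complex)" by (rule bcontfun_eqI) simp
  then show ?thesis using uniform_algebra_const[of 1] by simp
qed

lemma uniform_algebra_power: "a \<in> A \<Longrightarrow> a ^ n \<in> A"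
  by (induction n) (auto intro: uniform_algebra_one uniform_algebra_mult)

lemma uniform_algebra_sum: "(\<And>i. i \<in> I \<Longrightarrow> a i \<in> A) \<Longrightarrow> sum a I \<in> A"
proof (induction I rule: infinite_finite_induct)
  case (insert i I)
  then show ?case by (auto intro: uniform_algebra_add)
qed (use uniform_algebra_const[of 0] in auto)

text \<open>If \<open>w\<close> inverts \<open>h * k\<close>, then \<open>k * w\<close> inverts
  \<open>h\<close>. The main argument shows only that such a product is close to
  \<open>1\<close>.\<close>

lemma invertibles_cancel_right:
  assumes "h \<in> A" "k \<in> A" "h * k \<in> invertibles A"
  shows "h \<in> invertibles A"
proof -
  from assms(3) obtain w where "w \<in> A" "h * k * w = 1"
    by (auto simp: invertibles_def)
  with assms(1,2) show ?thesis
    by (auto simp: invertibles_def mult.assoc intro!: uniform_algebra_mult bexI[of _ "k * w"])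
qed

text \<open>The inverse exists in \<open>C(\<Omega>)\<close>; the Neumann series is used only to see that it lies in \<open>A\<close>.\<close>

lemma invertibles_near_one:
  assumes cpt: "compact (UNIV :: 'a set)" and "u \<in> A" "norm (1 - u) < 1"
  shows "u \<in> invertibles A"
proof -
  define v where "v = 1 - u"
  have v: "v \<in> A" "norm v < 1" "u = 1 - v"
    using assms by (auto simp: v_def intro: uniform_algebra_diff uniform_algebra_one)
  have "apply_bcontfun u x \<noteq> 0" for x
  proof
    assume "apply_bcontfun u x = 0"
    then have "apply_bcontfun v x = 1" by (simp add: v_def)
    with norm_bounded[of v x] v(2) show False by simp
  qed
  then obtain w where w: "u * w = 1" using bcontfun_inverse_exists[OF cpt] by blast
  \<comment> \<open>Multiplying the telescoped geometric sum by \<open>w\<close> leaves the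
    remainder \<open>w * v ^ n\<close>, which tends to 0. Hence \<open>w\<close> is a limit of
    polynomials in \<open>v\<close>, and \<open>A\<close> is closed.\<close>
  have w_diff: "w - (\<Sum>i<n. v ^ i) = w * v ^ n" for n
  proof -
    have "1 - v ^ n = u * (\<Sum>i<n. v ^ i)"
      unfolding v(3) by (rule one_diff_power_eq)
    then have "w * (1 - v ^ n) = (\<Sum>i<n. v ^ i)"
      using w by (metis mult.assoc mult.commute mult_1)
    then show ?thesis by (simp add: algebra_simps)
  qed
  have "(\<lambda>n. norm w * norm v ^ n) \<longlonglongrightarrow> 0"
    using v(2) by (intro tendsto_mult_right_zero LIMSEQ_realpow_zero) auto
  then have "(\<lambda>n. \<Sum>i<n. v ^ i) \<longlonglongrightarrow> w"
  proof (rule metric_tendsto_imp_tendsto)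
    show "\<forall>\<^sub>F n in sequentially. dist (\<Sum>i<n. v ^ i) w \<le> dist (norm w * norm v ^ n) 0"
    proof (intro always_eventually allI)
      fix n
      have "dist (\<Sum>i<n. v ^ i) w = norm (w * v ^ n)"
        by (metis dist_commute dist_norm w_diff)
      also have "\<dots> \<le> norm w * norm (v ^ n)" by (rule norm_mult_bcontfun_le)
      also have "\<dots> \<le> norm w * norm v ^ n"
        by (intro mult_left_mono norm_power_bcontfun_le) simp
      finally show "dist (\<Sum>i<n. v ^ i) w \<le> dist (norm w * norm v ^ n) 0" by simp
    qed
  qed
  moreover have "closed A" using ua by (simp add: uniform_algebra_def)
  moreover have "(\<Sum>i<n. v ^ i) \<in> A" for n
    by (intro uniform_algebra_sum uniform_algebra_power v)
  ultimately have "w \<in> A" by (meson closed_sequentially)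
  with w assms(2) show ?thesis by (auto simp: invertibles_def)
qed

end


subsection \<open>Peaking points form a boundary\<close>

text \<open>For a uniform algebra on a compact Hausdorff space this is the Shilov boundary,
  described locally: each neighbourhood of \<open>y\<close> contains the whole maximum modulus set
  of some nonzero element.\<close>

definition peaking_points :: "('a::topological_space \<Rightarrow>\<^sub>C complex) set \<Rightarrow> 'a set" where
  "peaking_points A = {y. \<forall>U. open U \<and> y \<in> U \<longrightarrow>
     (\<exists>a\<in>A. a \<noteq> 0 \<and> (\<forall>x. x \<notin> U \<longrightarrow> cmod (apply_bcontfun a x) < norm a))}"

text \<open>A neighbourhood \<open>U\<close> witnessing that \<open>y\<close> is not peaking is a
  witness for each of its points.\<close>

lemma closed_peaking_points: "closed (peaking_points A)"
  unfolding closed_def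
proof (rule topological_space_class.openI)
  fix y assume "y \<in> - peaking_points A"
  then obtain U where U: "open U" "y \<in> U"
    "\<not> (\<exists>a\<in>A. a \<noteq> 0 \<and> (\<forall>x. x \<notin> U \<longrightarrow> cmod (apply_bcontfun a x) < norm a))"
    unfolding peaking_points_def by blast
  then have "U \<subseteq> - peaking_points A"
    unfolding peaking_points_def by blast
  with U show "\<exists>U. open U \<and> y \<in> U \<and> U \<subseteq> - peaking_points A" by blast
qed

context
  fixes A :: "('a::t2_space \<Rightarrow>\<^sub>C complex) set"
  assumes cpt: "compact (UNIV :: 'a set)" and ua: "uniform_algebra A"
begin

lemma compact_closed: "closed E \<Longrightarrow> compact (E :: 'a set)"
  using compact_Int_closed[OF cpt, of E] by simp

lemma exists_normalized:
  assumes "a \<in> A" "a \<noteq> 0"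
  obtains b where "b \<in> A" "norm b = 1"
    "\<And>x. cmod (apply_bcontfun b x) = cmod (apply_bcontfun a x) / norm a"
proof (rule that[of "const_bcontfun (of_real (inverse (norm a))) * a"])
  show "norm (const_bcontfun (of_real (inverse (norm a))) * a) = 1"
    using assms(2) by (simp add: norm_const_bcontfun_mult del: of_real_inverse)
qed (use assms(1) in \<open>auto simp: norm_mult norm_divide divide_inverse norm_inverse
        intro: uniform_algebra_mult[OF ua] uniform_algebra_const[OF ua]\<close>)

text \<open>Each point of the compact complement of \<open>U\<close> is separated from
  \<open>y\<close> by an element of \<open>A\<close>, and a finite subcover leaves finitely many
  elements. Thus \<open>A\<close> determines the topology.\<close>

lemma separating_neighbourhood:
  assumes "open U" "y \<in> U"
  obtains F where "finite F" "F \<subseteq> A"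
    "\<And>x. (\<And>a. a \<in> F \<Longrightarrow> cmod (apply_bcontfun a x - apply_bcontfun a y) < 1) \<Longrightarrow> x \<in> U"
proof -
  define N where "N a = {x. 1 < cmod (apply_bcontfun a x - apply_bcontfun a y)}" for a
  have "open (N a)" for a
    unfolding N_def by (intro open_Collect_less continuous_intros) auto
  moreover have "\<exists>a\<in>A. x \<in> N a" if "x \<in> - U" for x
  proof -
    have "x \<noteq> y" using that assms by auto
    then obtain a where a: "a \<in> A" "apply_bcontfun a x \<noteq> apply_bcontfun a y"
      using ua unfolding uniform_algebra_def by blast
    define d where "d = apply_bcontfun a x - apply_bcontfun a y"
    have "d \<noteq> 0" using a by (simp add: d_def)
    \<comment> \<open>The factor \<open>2 / d\<close> turns the difference of the two values into
      exactly 2, above the threshold 1 in \<open>N\<close>.\<close>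
    have "apply_bcontfun (const_bcontfun (2 / d) * a) x - apply_bcontfun (const_bcontfun (2 / d) * a) y
        = 2 / d * d"
      by (simp only: times_bcontfun.rep_eq const_bcontfun.rep_eq d_def right_diff_distrib)
    also have "2 / d * d = 2" using \<open>d \<noteq> 0\<close> by simp
    finally have "x \<in> N (const_bcontfun (2 / d) * a)" by (simp add: N_def)
    moreover have "const_bcontfun (2 / d) * a \<in> A"
      using a by (intro uniform_algebra_mult[OF ua] uniform_algebra_const[OF ua])
    ultimately show ?thesis by blast
  qed
  then have "- U \<subseteq> (\<Union>a\<in>A. N a)" by blast
  moreover have "compact (- U)" using assms by (intro compact_closed) auto
  ultimately obtain F where F: "F \<subseteq> A" "finite F" "- U \<subseteq> (\<Union>a\<in>F. N a)"
    by (meson compactE_image)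
  show thesis
  proof (rule that[OF F(2,1)])
    fix x assume x: "\<And>a. a \<in> F \<Longrightarrow> cmod (apply_bcontfun a x - apply_bcontfun a y) < 1"
    have "x \<notin> N a" if "a \<in> F" for a
      using x[OF that] by (simp add: N_def)
    with F(3) show "x \<in> U" by blast
  qed
qed

lemma is_boundary_UNIV: "is_boundary A UNIV"
  unfolding is_boundary_def by (metis UNIV_I cpt norm_bcontfun_attained)

lemma is_boundaryI:
  assumes "\<And>a. a \<in> A \<Longrightarrow> a \<noteq> 0 \<Longrightarrow> \<exists>x\<in>E. norm a \<le> cmod (apply_bcontfun a x)"
  shows "is_boundary A E"
  unfolding is_boundary_def
proof
  fix a assume "a \<in> A"
  show "\<exists>x\<in>E. cmod (apply_bcontfun a x) = norm a"
  proof (cases "a = 0")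
    \<comment> \<open>For the zero function any point of \<open>E\<close> will do; the hypothesis
      applied to the function \<open>1\<close> provides one.\<close>
    case True
    with assms[OF uniform_algebra_one[OF ua]] show ?thesis by auto
  next
    case False
    with assms \<open>a \<in> A\<close> show ?thesis by (meson antisym norm_bounded)
  qed
qed

text \<open>Otherwise some \<open>g\<close> of norm 1 satisfies
  \<open>\<bar>g\<bar> \<le> r < 1\<close> on \<open>E - V\<close>. For \<open>c\<close> in
  \<open>F\<close> and large \<open>n\<close>, the product of \<open>g ^ n\<close> and
  \<open>c\<close> minus its value at \<open>y\<close> has modulus below 1 on \<open>E\<close>: on
  \<open>V\<close> by the second factor, off \<open>V\<close> by the first. As \<open>E\<close> is a
  boundary, the same holds on the whole space, so every point with \<open>\<bar>g\<bar> = 1\<close>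
  lies in \<open>V\<close>. But \<open>- V\<close> is a boundary, a contradiction.\<close>

lemma boundary_remove:
  assumes "finite F" "F \<subseteq> A"
    and V: "V = {x. \<forall>a\<in>F. cmod (apply_bcontfun a x - apply_bcontfun a y) < 1}"
    and "is_boundary A (- V)" "closed E" "is_boundary A E"
  shows "closed (E - V)" "is_boundary A (E - V)"
proof -
  have "open {x. cmod (apply_bcontfun a x - apply_bcontfun a y) < 1}" for a
    by (intro open_Collect_less continuous_intros) auto
  then have "open V" using assms(1) unfolding V
    by (auto simp: Collect_ball_eq)
  with \<open>closed E\<close> show clo: "closed (E - V)" by (rule closed_Diff)
  show "is_boundary A (E - V)"
  proof (rule is_boundaryI, rule ccontr)
    fix a assume a: "a \<in> A" "a \<noteq> 0" "\<not> (\<exists>x\<in>E - V. norm a \<le> cmod (apply_bcontfun a x))"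
    obtain g where g: "g \<in> A" "norm g = 1"
        "\<And>x. cmod (apply_bcontfun g x) = cmod (apply_bcontfun a x) / norm a"
      using exists_normalized[OF a(1,2)] by metis
    have "cmod (apply_bcontfun g x) < 1" if "x \<in> E - V" for x
      using a that by (auto simp: g not_le)
    then obtain r where r: "0 \<le> r" "r < 1" "\<And>x. x \<in> E - V \<Longrightarrow> cmod (apply_bcontfun g x) \<le> r"
      using less_norm_imp_uniformly_less[OF compact_closed[OF clo], of g 1] by auto
    \<comment> \<open>\<open>K\<close> bounds the oscillation of every element of \<open>F\<close>,
      so that one exponent \<open>n\<close> serves them all.\<close>
    define K where "K = (\<Sum>a\<in>F. norm a + norm a)"
    have K: "norm a + norm a \<le> K" if "a \<in> F" for a
      unfolding K_def using assms(1) that by (intro member_le_sum) auto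
    obtain n where n: "r ^ n * K < 1" using exists_power_mult_less[OF r(1,2), of 1 K] by auto
    have less: "cmod (apply_bcontfun c x - apply_bcontfun c y) < 1"
      if "c \<in> F" "cmod (apply_bcontfun g x) = 1" for c x
    proof -
      define d where "d = g ^ n * (c - const_bcontfun (apply_bcontfun c y))"
      have "d \<in> A" unfolding d_def using that(1) assms(2) g(1)
        by (intro uniform_algebra_mult[OF ua] uniform_algebra_power[OF ua]
            uniform_algebra_diff[OF ua] uniform_algebra_const[OF ua]) auto
      then obtain z where z: "z \<in> E" "cmod (apply_bcontfun d z) = norm d"
        using assms(6) unfolding is_boundary_def by blast
      have d_eq: "cmod (apply_bcontfun d z) =
        cmod (apply_bcontfun g z) ^ n * cmod (apply_bcontfun c z - apply_bcontfun c y)" for z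
        by (simp add: d_def norm_mult norm_power)
      have "cmod (apply_bcontfun d z) < 1"
      proof (cases "z \<in> V")
        case True
        then have "cmod (apply_bcontfun c z - apply_bcontfun c y) < 1" using that(1) by (auto simp: V)
        moreover have "cmod (apply_bcontfun g z) ^ n \<le> 1"
          using norm_bounded[of g z] g(2) by (intro power_le_one) auto
        ultimately show ?thesis unfolding d_eq
          by (meson le_less_trans mult_left_le_one_le norm_ge_zero zero_le_power)
      next
        case False
        have "cmod (apply_bcontfun c z - apply_bcontfun c y) \<le> norm c + norm c"
          by (intro order_trans[OF norm_triangle_ineq4] add_mono norm_bounded)
        also have "\<dots> \<le> K" by (rule K[OF that(1)])
        finally have "cmod (apply_bcontfun d z) \<le> r ^ n * K"
          unfolding d_eq using r z(1) False by (intro mult_mono power_mono) auto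
        with n show ?thesis by simp
      qed
      then have "cmod (apply_bcontfun d x) < 1"
        using norm_bounded[of d x] z(2) by simp
      then show ?thesis unfolding d_eq that(2) by simp
    qed
    obtain x where "x \<notin> V" "cmod (apply_bcontfun g x) = 1"
      using assms(4) g(1,2) unfolding is_boundary_def by (metis ComplD)
    with less show False by (auto simp: V)
  qed
qed

text \<open>
  A point that is not peaking has a neighbourhood that can be removed from every closed boundary.
  If some \<open>g\<close> attained its norm only at such points, finitely many removals would leave a
  boundary on which \<open>g\<close> does not attain its norm.
\<close>

theorem is_boundary_peaking_points: "is_boundary A (peaking_points A)"
proof (rule is_boundaryI, rule ccontr)
  fix g assume g: "g \<in> A" "\<not> (\<exists>x\<in>peaking_points A. norm g \<le> cmod (apply_bcontfun g x))"
  define Z where "Z = {x. norm g \<le> cmod (apply_bcontfun g x)}"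
  have "closed Z" unfolding Z_def by (intro closed_Collect_le continuous_intros) auto
  \<comment> \<open>Removability is required for all closed boundaries at once, so that removals can
    be iterated.\<close>
  define \<V> where "\<V> = {V. open V \<and>
    (\<forall>E. closed E \<and> is_boundary A E \<longrightarrow> closed (E - V) \<and> is_boundary A (E - V))}"
  have "\<exists>V\<in>\<V>. y \<in> V" if "y \<in> Z" for y
  proof -
    from that g have "y \<notin> peaking_points A" by (auto simp: Z_def)
    then obtain U where U: "open U" "y \<in> U"
      "\<And>a. a \<in> A \<Longrightarrow> a \<noteq> 0 \<Longrightarrow> \<exists>x. x \<notin> U \<and> norm a \<le> cmod (apply_bcontfun a x)"
      unfolding peaking_points_def by (auto simp: not_less)
    from separating_neighbourhood[OF U(1,2)] obtain F where F: "finite F" "F \<subseteq> A"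
      "\<And>x. (\<And>a. a \<in> F \<Longrightarrow> cmod (apply_bcontfun a x - apply_bcontfun a y) < 1) \<Longrightarrow> x \<in> U"
      by metis
    define V where "V = {x. \<forall>a\<in>F. cmod (apply_bcontfun a x - apply_bcontfun a y) < 1}"
    have "V \<subseteq> U" using F(3) by (auto simp: V_def)
    \<comment> \<open>Every nonzero element reaches its norm off \<open>U\<close>, hence off the
      smaller set \<open>V\<close>.\<close>
    then have "is_boundary A (- V)" using U(3) by (intro is_boundaryI) blast
    from boundary_remove[OF F(1,2) V_def this]
    have "\<forall>E. closed E \<and> is_boundary A E \<longrightarrow> closed (E - V) \<and> is_boundary A (E - V)" by blast
    moreover have "open {x. cmod (apply_bcontfun a x - apply_bcontfun a y) < 1}" for a
      by (intro open_Collect_less continuous_intros) auto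
    then have "open V" using F(1) by (auto simp: V_def Collect_ball_eq)
    moreover have "y \<in> V" by (simp add: V_def)
    ultimately show ?thesis by (auto simp: \<V>_def)
  qed
  then have "Z \<subseteq> \<Union>\<V>" by blast
  moreover have "\<And>V. V \<in> \<V> \<Longrightarrow> open V" by (simp add: \<V>_def)
  ultimately obtain \<W> where W: "\<W> \<subseteq> \<V>" "finite \<W>" "Z \<subseteq> \<Union>\<W>"
    using compactE[OF compact_closed[OF \<open>closed Z\<close>]] by metis
  have "closed (UNIV - \<Union>\<W>) \<and> is_boundary A (UNIV - \<Union>\<W>)"
    using W(2,1)
  proof (induction \<W> rule: finite_induct)
    case (insert V \<W>)
    then have "V \<in> \<V>" "closed (UNIV - \<Union>\<W>) \<and> is_boundary A (UNIV - \<Union>\<W>)" by auto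
    then have "closed (UNIV - \<Union>\<W> - V) \<and> is_boundary A (UNIV - \<Union>\<W> - V)"
      unfolding \<V>_def by blast
    moreover have "UNIV - \<Union>\<W> - V = UNIV - \<Union>(insert V \<W>)" by auto
    ultimately show ?case by simp
  qed (simp add: is_boundary_UNIV)
  then obtain x where "x \<notin> \<Union>\<W>" "cmod (apply_bcontfun g x) = norm g"
    using g(1) unfolding is_boundary_def by blast
  moreover from this have "x \<in> Z" by (simp add: Z_def)
  ultimately show False using W(3) by blast
qed

section \<open>Consequences of the boundary property, and peaking elements of the module\<close>

lemma Shilov_boundary_UNIV_imp_peaking:
  "is_Shilov_boundary A UNIV \<Longrightarrow> peaking_points A = UNIV"
  using closed_peaking_points is_boundary_peaking_points
  unfolding is_Shilov_boundary_def by blast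

lemma norm_le_if_le_on_peaking:
  assumes "a \<in> A" "\<And>y. y \<in> peaking_points A \<Longrightarrow> cmod (apply_bcontfun a y) \<le> c"
  shows "norm a \<le> c"
  using is_boundary_peaking_points assms unfolding is_boundary_def by metis

text \<open>Normalise \<open>a ^ n * f\<close>, where \<open>a\<close> has norm 1 and peaks inside
  \<open>U\<close>. Off \<open>U\<close> the power decays, while the norm stays at least
  \<open>m = min \<bar>f\<bar>\<close>-type bound, because \<open>\<bar>a\<bar> = 1\<close>
  somewhere. Such elements serve as test functions in the range of \<open>T\<close>.\<close>

lemma peaking_module_element:
  assumes y: "y \<in> peaking_points A" "open U" "y \<in> U"
    and "0 < \<eta>" and f: "\<And>x. apply_bcontfun f x \<noteq> 0"
  obtains p where "p \<in> principal_module A f" "norm p = 1"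
    "\<And>x. x \<notin> U \<Longrightarrow> cmod (apply_bcontfun p x) < \<eta>"
proof -
  from y obtain a0 where a0: "a0 \<in> A" "a0 \<noteq> 0"
    "\<And>x. x \<notin> U \<Longrightarrow> cmod (apply_bcontfun a0 x) < norm a0"
    unfolding peaking_points_def by blast
  obtain a where a: "a \<in> A" "norm a = 1"
      "\<And>x. cmod (apply_bcontfun a x) = cmod (apply_bcontfun a0 x) / norm a0"
    using exists_normalized[OF a0(1,2)] by metis
  have "cmod (apply_bcontfun a x) < 1" if "x \<in> - U" for x
    using a0(2,3) that by (auto simp: a)
  moreover have "compact (- U)" using y by (intro compact_closed) auto
  ultimately obtain r where r: "0 \<le> r" "r < 1" "\<And>x. x \<in> - U \<Longrightarrow> cmod (apply_bcontfun a x) \<le> r"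
    using less_norm_imp_uniformly_less[of "- U" a 1] by auto
  obtain m where m: "0 < m" "\<And>x. m \<le> cmod (apply_bcontfun f x)"
    using bcontfun_bounded_below[OF cpt f] by blast
  obtain n where n: "r ^ n * norm f < \<eta> * m"
    using exists_power_mult_less[OF r(1,2), of "\<eta> * m" "norm f"] \<open>0 < \<eta>\<close> m(1) by auto
  define w where "w = a ^ n * f"
  obtain x0 where "cmod (apply_bcontfun a x0) = 1"
    using norm_bcontfun_attained[OF cpt, of a] a(2) by auto
  then have "m \<le> cmod (apply_bcontfun w x0)"
    using m(2)[of x0] by (simp add: w_def norm_mult norm_power)
  then have mw: "m \<le> norm w" using norm_bounded[of w x0] by simp
  define p where "p = const_bcontfun (of_real (inverse (norm w))) * w"
  show thesis
  proof (rule that[of p])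
    have "p = (const_bcontfun (of_real (inverse (norm w))) * a ^ n) * f"
      by (simp add: p_def w_def mult.assoc)
    then show "p \<in> principal_module A f" unfolding principal_module_def using a(1)
      by (auto intro!: uniform_algebra_mult[OF ua] uniform_algebra_power[OF ua]
          uniform_algebra_const[OF ua])
    have "norm w \<noteq> 0" using mw m(1) by linarith
    then show "norm p = 1"
      by (simp add: p_def norm_const_bcontfun_mult del: of_real_inverse)
    fix x assume "x \<notin> U"
    have "cmod (apply_bcontfun w x) \<le> r ^ n * norm f"
      unfolding w_def using r \<open>x \<notin> U\<close>
      by (auto simp: norm_mult norm_power intro!: mult_mono power_mono norm_bounded)
    also note n
    also have "\<eta> * m \<le> \<eta> * norm w" using mw \<open>0 < \<eta>\<close> by simp
    finally have "cmod (apply_bcontfun w x) < \<eta> * norm w" .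
    moreover have "cmod (apply_bcontfun p x) = cmod (apply_bcontfun w x) / norm w"
      by (simp only: p_def times_bcontfun.rep_eq const_bcontfun.rep_eq norm_mult norm_of_real)
        (simp add: divide_inverse mult.commute)
    moreover have "0 < norm w" using mw m(1) by linarith
    ultimately show "cmod (apply_bcontfun p x) < \<eta>"
      by (simp only: pos_divide_less_eq)
  qed
qed

end


subsection \<open>Isomorphisms\<close>

lemma norm_le_onorm_on:
  assumes "bounded_on X T" "x \<in> X"
  shows "norm (T x) \<le> onorm_on X T * norm x"
proof (cases "x = 0")
  case True
  with assms show ?thesis by (auto simp: bounded_on_def)
next
  case False
  from assms(1) obtain K where K: "\<And>x. x \<in> X \<Longrightarrow> norm (T x) \<le> K * norm x"
    unfolding bounded_on_def by blast
  \<comment> \<open>The quotient at \<open>x = 0\<close> is 0, so the bound has to be made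
    nonnegative.\<close>
  have "norm (T x) / norm x \<le> max K 0" if "x \<in> X" for x
    using K[OF that] order_trans[OF K[OF that] mult_right_mono[of K "max K 0" "norm x"]]
    by (cases "x = 0") (auto simp: pos_divide_le_eq)
  then have "bdd_above ((\<lambda>x. norm (T x) / norm x) ` X)" by (auto simp: bdd_above_def)
  then have "norm (T x) / norm x \<le> onorm_on X T"
    unfolding onorm_on_def using assms(2) by (rule cSUP_upper[rotated])
  with False show ?thesis by (simp add: divide_simps)
qed

lemma onorm_on_le:
  assumes "X \<noteq> {}" "0 \<le> K" "\<And>x. x \<in> X \<Longrightarrow> norm (T x) \<le> K * norm x"
  shows "onorm_on X T \<le> K"
  unfolding onorm_on_def
proof (rule cSUP_least[OF assms(1)])
  fix x assume "x \<in> X"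
  with assms(2,3) show "norm (T x) / norm x \<le> K"
    by (cases "x = 0") (auto simp: divide_simps)
qed

section \<open>Normalised almost isometries, and module isomorphisms given by multipliers\<close>

context
  fixes A :: "('a::t2_space \<Rightarrow>\<^sub>C complex) set" and f :: "'a \<Rightarrow>\<^sub>C complex"
  assumes ua: "uniform_algebra A"
begin

text \<open>Divide \<open>T\<close> by its norm \<open>M\<close>, which is positive because
  injectivity gives \<open>T 1 \<noteq> 0\<close>. The bound on the product of the two norms then
  falls entirely on the inverse.\<close>

lemma almost_isometric_imp_normalized:
  assumes "almost_isometric A (principal_module A f)" "0 < \<epsilon>"
  obtains T where "complex_linear_on A T" "T ` A = principal_module A f"
    "\<And>a. a \<in> A \<Longrightarrow> norm (T a) \<le> norm a"
    "\<And>a. a \<in> A \<Longrightarrow> norm a \<le> (1 + \<epsilon>) * norm (T a)"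
proof -
  let ?B = "principal_module A f"
  obtain T where T: "linear_isomorphism A ?B T"
    and prod: "onorm_on A T * onorm_on ?B (inv_into A T) < 1 + \<epsilon>"
    using assms unfolding almost_isometric_def by blast
  define M where "M = onorm_on A T"
  define N where "N = onorm_on ?B (inv_into A T)"
  from T have lin: "complex_linear_on A T" and bij: "bij_betw T A ?B"
    and bd: "bounded_on A T" "bounded_on ?B (inv_into A T)"
    by (auto simp: linear_isomorphism_def)
  have one: "1 \<in> A" and zero: "0 \<in> A"
    using uniform_algebra_one[OF ua] uniform_algebra_const[OF ua, of 0] by auto
  have "T (const_bcontfun 0 * 0) = const_bcontfun 0 * T 0"
    using lin zero unfolding complex_linear_on_def by blast
  then have "T 0 = 0" by simp
  then have "T 1 \<noteq> 0" using bij one zero unfolding bij_betw_def inj_on_def by (metis one_neq_zero)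
  moreover have M: "norm (T a) \<le> M * norm a" if "a \<in> A" for a
    unfolding M_def using bd(1) that by (rule norm_le_onorm_on)
  ultimately have "0 < M"
    using M[OF one] by (metis less_le_trans mult_less_0_iff not_less norm_ge_zero
        zero_less_norm_iff zero_less_mult_iff)
  have N: "norm a \<le> N * norm (T a)" if "a \<in> A" for a
    using norm_le_onorm_on[OF bd(2), of "T a"] bij that
    by (simp add: N_def bij_betw_def bij_betwE inv_into_f_f)
  let ?S = "\<lambda>a. const_bcontfun (of_real (inverse M)) * T a"
  show thesis
  proof (rule that[of ?S])
    show "complex_linear_on A ?S"
      using lin unfolding complex_linear_on_def by (auto simp: algebra_simps)
    have scale: "const_bcontfun c * b \<in> ?B" if "b \<in> ?B" for b c
    proof -
      from that obtain a where "a \<in> A" "b = a * f" by (auto simp: principal_module_def)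
      then have "const_bcontfun c * b = (const_bcontfun c * a) * f" "const_bcontfun c * a \<in> A"
        using uniform_algebra_mult[OF ua] uniform_algebra_const[OF ua] by (auto simp: mult.assoc)
      then show ?thesis unfolding principal_module_def by blast
    qed
    show "?S ` A = ?B"
    proof
      show "?S ` A \<subseteq> ?B" using bij scale by (auto simp: bij_betw_def)
      show "?B \<subseteq> ?S ` A"
      proof
        fix b assume "b \<in> ?B"
        then have "const_bcontfun (of_real M) * b \<in> T ` A"
          using scale bij by (simp add: bij_betw_def)
        then obtain a where a: "a \<in> A" "T a = const_bcontfun (of_real M) * b" by auto
        then have "b = ?S a" using \<open>0 < M\<close> by (intro bcontfun_eqI) simp
        with a(1) show "b \<in> ?S ` A" by blast
      qed
    qed
    have norm_S: "norm (?S a) = norm (T a) / M" for a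
      using \<open>0 < M\<close> by (simp only: norm_const_bcontfun_mult norm_of_real) (simp add: divide_inverse mult.commute)
    fix a assume a: "a \<in> A"
    show "norm (?S a) \<le> norm a"
      unfolding norm_S using M[OF a] \<open>0 < M\<close> by (simp add: divide_simps mult.commute)
    have "norm a \<le> (M * N) * norm (?S a)"
      unfolding norm_S using N[OF a] \<open>0 < M\<close> by simp
    also have "\<dots> \<le> (1 + \<epsilon>) * norm (?S a)"
      using prod by (intro mult_right_mono) (auto simp: M_def N_def)
    finally show "norm a \<le> (1 + \<epsilon>) * norm (?S a)" .
  qed
qed

text \<open>The map is \<open>a \<mapsto> a * h * f\<close>. The lower estimate gives injectivity
  and bounds the inverse map; the inverse of \<open>h\<close> in \<open>A\<close> gives surjectivity
  onto the module.\<close>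

lemma almost_module_isometricI:
  assumes "\<And>\<delta>. 0 < \<delta> \<Longrightarrow> \<delta> < 1 \<Longrightarrow> \<exists>h\<in>invertibles A. \<forall>a\<in>A.
    (1 - \<delta>) * norm a \<le> norm (a * h * f) \<and> norm (a * h * f) \<le> (1 + \<delta>) * norm a"
  shows "almost_module_isometric A A (principal_module A f)"
  unfolding almost_module_isometric_def
proof (intro allI impI)
  fix \<epsilon> :: real assume "0 < \<epsilon>"
  let ?B = "principal_module A f"
  \<comment> \<open>With this choice \<open>(1 + \<delta>) / (1 - \<delta>)\<close> equals
    \<open>1 + 2 * \<epsilon> / 3\<close>.\<close>
  define \<delta> where "\<delta> = \<epsilon> / (3 + \<epsilon>)"
  have \<delta>: "0 < \<delta>" "\<delta> < 1" "(1 + \<delta>) / (1 - \<delta>) < 1 + \<epsilon>"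
    using \<open>0 < \<epsilon>\<close> by (auto simp: \<delta>_def divide_simps algebra_simps intro: add_pos_pos)
  from assms[OF \<delta>(1,2)] obtain h where h: "h \<in> invertibles A"
    and lower: "\<And>a. a \<in> A \<Longrightarrow> (1 - \<delta>) * norm a \<le> norm (a * h * f)"
    and upper: "\<And>a. a \<in> A \<Longrightarrow> norm (a * h * f) \<le> (1 + \<delta>) * norm a"
    by blast
  from h obtain k where k: "h \<in> A" "k \<in> A" "h * k = 1" by (auto simp: invertibles_def)
  let ?T = "\<lambda>a. a * h * f"
  have bij: "bij_betw ?T A ?B"
  proof (rule bij_betw_imageI)
    show "inj_on ?T A"
    proof (rule inj_onI)
      fix a b assume ab: "a \<in> A" "b \<in> A" "?T a = ?T b"
      then have "(1 - \<delta>) * norm (a - b) \<le> norm (?T (a - b))"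
        by (intro lower uniform_algebra_diff[OF ua])
      also have "?T (a - b) = 0" using ab(3) by (simp add: algebra_simps)
      finally show "a = b" using \<delta>(2) by (simp add: mult_le_0_iff)
    qed
    show "?T ` A = ?B"
    proof
      show "?T ` A \<subseteq> ?B"
        unfolding principal_module_def using k(1) uniform_algebra_mult[OF ua] by blast
      show "?B \<subseteq> ?T ` A"
      proof
        fix b assume "b \<in> ?B"
        then obtain a where a: "a \<in> A" "b = a * f" by (auto simp: principal_module_def)
        have "?T (a * k) = a * (h * k) * f" by (simp add: mult_ac)
        then have "b = ?T (a * k)" using a k by simp
        with uniform_algebra_mult[OF ua a(1) k(2)] show "b \<in> ?T ` A" by blast
      qed
    qed
  qed
  have inv_bound: "norm (inv_into A ?T b) \<le> 1 / (1 - \<delta>) * norm b" if "b \<in> ?B" for b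
  proof -
    have "b \<in> ?T ` A" using bij that by (simp add: bij_betw_def)
    then have "inv_into A ?T b \<in> A" "?T (inv_into A ?T b) = b"
      by (rule inv_into_into, rule f_inv_into_f)
    with lower[of "inv_into A ?T b"] \<delta>(2) show ?thesis
      by (simp add: field_simps)
  qed
  have ne: "1 \<in> A" "1 * f \<in> ?B" using uniform_algebra_one[OF ua] unfolding principal_module_def by blast+
  have bounded: "bounded_on A ?T" "bounded_on ?B (inv_into A ?T)"
    using upper inv_bound unfolding bounded_on_def by blast+
  moreover have "complex_linear_on A ?T"
    by (simp add: complex_linear_on_def algebra_simps)
  ultimately have "linear_isomorphism A ?B ?T"
    using bij by (simp add: linear_isomorphism_def)
  moreover have "module_map_on A A ?T" by (simp add: module_map_on_def mult.assoc)
  moreover have "onorm_on A ?T * onorm_on ?B (inv_into A ?T) \<le> (1 + \<delta>) * (1 / (1 - \<delta>))"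
  proof (rule mult_mono)
    show "onorm_on A ?T \<le> 1 + \<delta>" using ne(1) \<delta> upper by (intro onorm_on_le) auto
    show "onorm_on ?B (inv_into A ?T) \<le> 1 / (1 - \<delta>)"
      using ne(2) \<delta> inv_bound by (intro onorm_on_le) auto
    \<comment> \<open>That the supremum is nonnegative is read off at the nonzero module element
      \<open>f\<close>.\<close>
    from norm_le_onorm_on[OF bounded(2) ne(2)] have "0 \<le> onorm_on ?B (inv_into A ?T) * norm (1 * f)"
      by (rule order_trans[OF norm_ge_zero])
    moreover have "f \<noteq> 0" using lower[OF ne(1)] \<delta>(2) by (auto simp: mult_le_0_iff)
    ultimately show "0 \<le> onorm_on ?B (inv_into A ?T)"
      by (auto simp: zero_le_mult_iff)
  qed (use \<delta> in auto)
  ultimately show "\<exists>T. linear_isomorphism A ?B T \<and> module_map_on A A T \<and>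
      onorm_on A T * onorm_on ?B (inv_into A T) < 1 + \<epsilon>"
    using \<delta>(3) by (intro exI[of _ ?T]) auto
qed

end

lemma almost_module_isometric_imp_almost_isometric:
  "almost_module_isometric A X Y \<Longrightarrow> almost_isometric X Y"
  unfolding almost_module_isometric_def almost_isometric_def by blast


subsection \<open>Nearly isometric maps are nearly weighted composition maps\<close>

text \<open>Rotating \<open>w\<close> onto the ray through \<open>z\<close> turns the triangle
  inequality into an equality. The polar form also covers zero arguments.\<close>

lemma exists_unit_aligning:
  obtains l :: complex where "cmod l = 1" "cmod (z + l * w) = cmod z + cmod w"
proof (rule that[of "cis (Arg z - Arg w)"])
  have polar: "u = of_real (cmod u) * cis (Arg u)" for u
    by (metis rcis_cmod_Arg rcis_def)
  have "cis (Arg z - Arg w) * (of_real (cmod w) * cis (Arg w)) = of_real (cmod w) * cis (Arg z)"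
    by (simp add: cis_mult)
  then have "z + cis (Arg z - Arg w) * w = of_real (cmod z + cmod w) * cis (Arg z)"
    unfolding polar[of w, symmetric] using polar[of z] by (simp add: distrib_right)
  then show "cmod (z + cis (Arg z - Arg w) * w) = cmod z + cmod w"
    by (simp add: norm_mult del: of_real_add)
qed simp

context
  fixes A :: "('a::t2_space \<Rightarrow>\<^sub>C complex) set" and f :: "'a \<Rightarrow>\<^sub>C complex" and T \<epsilon>
  assumes cpt: "compact (UNIV :: 'a set)" and ua: "uniform_algebra A"
    and f: "\<And>x. apply_bcontfun f x \<noteq> 0"
    and lin: "complex_linear_on A T" and im: "T ` A = principal_module A f"
    and contr: "\<And>a. a \<in> A \<Longrightarrow> norm (T a) \<le> norm a"
    and expand: "\<And>a. a \<in> A \<Longrightarrow> norm a \<le> (1 + \<epsilon>) * norm (T a)"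
    and \<epsilon>: "0 < \<epsilon>"
begin

lemma T_add: "a \<in> A \<Longrightarrow> b \<in> A \<Longrightarrow> T (a + b) = T a + T b"
  and T_scale: "a \<in> A \<Longrightarrow> T (const_bcontfun c * a) = const_bcontfun c * T a"
  using lin unfolding complex_linear_on_def by blast+

text \<open>
  Let \<open>p = T q\<close> peak near \<open>y\<close>, and let \<open>\<bar>q\<bar>\<close> attain its norm at \<open>x\<close>. A rotation of \<open>c\<close> makes
  \<open>\<parallel>q + c\<parallel> \<ge> 1 + \<bar>c x\<bar>\<close>, while \<open>\<parallel>p + T c\<parallel>\<close> hardly exceeds \<open>1 + \<bar>T c y\<bar>\<close>.
\<close>

lemma exists_dominated_point_unit:
  assumes y: "y \<in> peaking_points A" and C: "finite C" "C \<subseteq> A" "\<And>c. c \<in> C \<Longrightarrow> norm c \<le> 1"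
  obtains x where
    "\<And>c. c \<in> C \<Longrightarrow> cmod (apply_bcontfun c x) \<le> cmod (apply_bcontfun (T c) y) + 3 * \<epsilon>"
proof -
  \<comment> \<open>Since \<open>(1 + \<epsilon>) * \<eta> = \<epsilon>\<close>, the final error is
    \<open>3 * \<epsilon>\<close>: one \<open>\<epsilon>\<close> each from the constant 1, from
    \<open>\<bar>T c y\<bar> \<le> 1\<close> and from \<open>\<eta>\<close>.\<close>
  define \<eta> where "\<eta> = \<epsilon> / (1 + \<epsilon>)"
  have \<eta>: "0 < \<eta>" "(1 + \<epsilon>) * \<eta> = \<epsilon>" using \<epsilon> by (auto simp: \<eta>_def)
  define U where
    "U = {z. \<forall>c\<in>C. cmod (apply_bcontfun (T c) z - apply_bcontfun (T c) y) < \<eta>}"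
  have "open {z. cmod (apply_bcontfun (T c) z - apply_bcontfun (T c) y) < \<eta>}" for c
    by (intro open_Collect_less continuous_intros) auto
  then have U: "open U" "y \<in> U" using C(1) \<eta> by (auto simp: U_def Collect_ball_eq)
  obtain p where p: "p \<in> principal_module A f" "norm p = 1"
    "\<And>x. x \<notin> U \<Longrightarrow> cmod (apply_bcontfun p x) < \<eta>"
    using peaking_module_element[OF cpt ua y U \<eta>(1) f] by metis
  from p(1) im obtain q where q: "q \<in> A" "T q = p" by (metis imageE)
  obtain x where x: "cmod (apply_bcontfun q x) = norm q" using norm_bcontfun_attained[OF cpt] by blast
  have q_ge: "1 \<le> norm q" using contr[OF q(1)] p(2) q(2) by simp
  show thesis
  proof (rule that[of x])
    fix c assume c: "c \<in> C"
    then have cA: "c \<in> A" and nc: "norm c \<le> 1" using C by auto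
    obtain l where l: "cmod l = 1"
      "cmod (apply_bcontfun q x + l * apply_bcontfun c x)
        = cmod (apply_bcontfun q x) + cmod (apply_bcontfun c x)"
      by (rule exists_unit_aligning)
    let ?e = "q + const_bcontfun l * c"
    have e: "?e \<in> A" "T ?e = p + const_bcontfun l * T c"
      using cA q by (simp_all add: T_add T_scale uniform_algebra_add[OF ua]
          uniform_algebra_mult[OF ua] uniform_algebra_const[OF ua])
    obtain z where z: "cmod (apply_bcontfun (T ?e) z) = norm (T ?e)"
      using norm_bcontfun_attained[OF cpt] by blast
    have "1 + cmod (apply_bcontfun c x) \<le> cmod (apply_bcontfun ?e x)"
      using l(2) x q_ge by simp
    also have "\<dots> \<le> norm ?e" by (rule norm_bounded)
    also have "\<dots> \<le> (1 + \<epsilon>) * norm (T ?e)" by (rule expand[OF e(1)])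
    also have "norm (T ?e) \<le> cmod (apply_bcontfun p z) + cmod (apply_bcontfun (T c) z)"
      using z l(1) norm_triangle_ineq[of "apply_bcontfun p z" "l * apply_bcontfun (T c) z"]
      unfolding e(2) by (simp add: norm_mult)
    also have "\<dots> \<le> 1 + cmod (apply_bcontfun (T c) y) + \<eta>"
    \<comment> \<open>Inside \<open>U\<close>, \<open>T c\<close> is within \<open>\<eta>\<close> of
      its value at \<open>y\<close> and \<open>\<bar>p\<bar> \<le> 1\<close>; outside,
      \<open>\<bar>p\<bar> < \<eta>\<close> and \<open>\<bar>T c\<bar> \<le> 1\<close>.\<close>
    proof (cases "z \<in> U")
      case True
      then have "cmod (apply_bcontfun (T c) z - apply_bcontfun (T c) y) < \<eta>"
        using c by (auto simp: U_def)
      then have "cmod (apply_bcontfun (T c) z) \<le> cmod (apply_bcontfun (T c) y) + \<eta>"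
        by (smt (verit) norm_triangle_sub)
      with norm_bounded[of p z] p(2) show ?thesis by simp
    next
      case False
      have "cmod (apply_bcontfun (T c) z) \<le> 1"
        using norm_bounded[of "T c" z] contr[OF cA] nc by linarith
      with p(3)[OF False] show ?thesis by (smt (verit) norm_ge_zero)
    qed
    finally have "1 + cmod (apply_bcontfun c x)
        \<le> (1 + \<epsilon>) * (1 + cmod (apply_bcontfun (T c) y) + \<eta>)"
      using \<epsilon> by simp
    also have "\<dots> = 1 + cmod (apply_bcontfun (T c) y) + \<epsilon> * cmod (apply_bcontfun (T c) y) + 2 * \<epsilon>"
      using \<eta>(2) by (simp add: algebra_simps)
    also have "\<epsilon> * cmod (apply_bcontfun (T c) y) \<le> \<epsilon> * 1"
      using norm_bounded[of "T c" y] contr[OF cA] nc \<epsilon> by (intro mult_left_mono) auto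
    finally show "cmod (apply_bcontfun c x) \<le> cmod (apply_bcontfun (T c) y) + 3 * \<epsilon>" by simp
  qed
qed

text \<open>Rescale all of \<open>C\<close> by \<open>1 / K\<close>; the additive error is scaled
  back by \<open>K\<close>.\<close>

lemma exists_dominated_point:
  assumes y: "y \<in> peaking_points A"
    and C: "finite C" "C \<subseteq> A" "\<And>c. c \<in> C \<Longrightarrow> norm c \<le> K" and "0 < K"
  obtains x where
    "\<And>c. c \<in> C \<Longrightarrow> cmod (apply_bcontfun c x) \<le> cmod (apply_bcontfun (T c) y) + 3 * \<epsilon> * K"
proof -
  let ?s = "\<lambda>c. const_bcontfun (of_real (inverse K)) * c"
  have s: "?s c \<in> A" "norm (?s c) \<le> 1" if c: "c \<in> C" for c
  proof -
    show "?s c \<in> A" using c C(2) by (auto intro!: uniform_algebra_mult[OF ua] uniform_algebra_const[OF ua])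
    have "norm (?s c) = norm c / K"
      using \<open>0 < K\<close> by (simp only: norm_const_bcontfun_mult norm_of_real) (simp add: divide_inverse mult.commute)
    with C(3)[OF c] \<open>0 < K\<close> show "norm (?s c) \<le> 1" by simp
  qed
  obtain x where x: "\<And>c. c \<in> ?s ` C \<Longrightarrow>
      cmod (apply_bcontfun c x) \<le> cmod (apply_bcontfun (T c) y) + 3 * \<epsilon>"
    using exists_dominated_point_unit[OF y, of "?s ` C"] C(1) s by blast
  show thesis
  proof (rule that[of x])
    fix c assume c: "c \<in> C"
    then have "cmod (apply_bcontfun (?s c) x) \<le> cmod (apply_bcontfun (T (?s c)) y) + 3 * \<epsilon>"
      by (intro x) auto
    also have "T (?s c) = ?s (T c)" using c C(2) by (intro T_scale) auto
    finally show "cmod (apply_bcontfun c x) \<le> cmod (apply_bcontfun (T c) y) + 3 * \<epsilon> * K"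
      using \<open>0 < K\<close> by (simp add: norm_mult norm_inverse norm_divide field_simps)
  qed
qed

text \<open>The constant \<open>1\<close> has modulus 1 wherever the dominated point lies, so
  domination bounds \<open>T 1\<close> from below at \<open>y\<close>.\<close>

lemma cmod_T_one_ge:
  assumes "y \<in> peaking_points A"
  shows "1 - 3 * \<epsilon> \<le> cmod (apply_bcontfun (T 1) y)"
proof -
  have "norm (1 :: 'a \<Rightarrow>\<^sub>C complex) \<le> 1" by (rule norm_bound) simp
  then obtain x where "cmod (apply_bcontfun 1 x) \<le> cmod (apply_bcontfun (T 1) y) + 3 * \<epsilon> * 1"
    using exists_dominated_point[OF assms, of "{1}" 1] uniform_algebra_one[OF ua] by auto
  then show ?thesis by simp
qed

lemma cmod_T_one_le: "cmod (apply_bcontfun (T 1) y) \<le> 1"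
proof -
  have "norm (1 :: 'a \<Rightarrow>\<^sub>C complex) \<le> 1" by (rule norm_bound) simp
  with norm_bounded[of "T 1" y] contr[OF uniform_algebra_one[OF ua]] show ?thesis by linarith
qed

text \<open>
  \<open>T b - b x T 1\<close> and \<open>T (b\<^sup>2) - (b x)\<^sup>2 T 1\<close> are both small at \<open>y\<close>, because the two test elements
  below are mapped by \<open>T\<close> to functions that vanish at \<open>y\<close>.
\<close>

lemma T_one_mult_T_square:
  assumes y: "y \<in> peaking_points A" and b: "b \<in> A" "norm b \<le> 1"
  shows "cmod (apply_bcontfun (T 1) y * apply_bcontfun (T (b * b)) y - (apply_bcontfun (T b) y)\<^sup>2)
    \<le> 18 * \<epsilon>"
proof -
  define t where "t = apply_bcontfun (T 1) y"
  define c where "c d = const_bcontfun t * d - const_bcontfun (apply_bcontfun (T d) y)" for d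
  have one: "1 \<in> A" by (rule uniform_algebra_one[OF ua])
  have t: "cmod t \<le> 1" unfolding t_def by (rule cmod_T_one_le)
  have bb: "b * b \<in> A" "norm (b * b) \<le> 1"
    using b norm_mult_bcontfun_le[of b b] mult_mono[OF b(2) b(2)]
    by (auto intro: uniform_algebra_mult[OF ua])
  have c: "c d \<in> A" "norm (c d) \<le> 2" "apply_bcontfun (T (c d)) y = 0"
    if d: "d \<in> A" "norm d \<le> 1" for d
  proof -
    show "c d \<in> A" unfolding c_def using d
      by (intro uniform_algebra_mult[OF ua] uniform_algebra_diff[OF ua] uniform_algebra_const[OF ua])
    show "norm (c d) \<le> 2"
    proof (rule norm_bound)
      fix x
      have "cmod (apply_bcontfun (T d) y) \<le> 1"
        using norm_bounded[of "T d" y] contr[OF d(1)] d(2) by linarith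
      moreover have "cmod (t * apply_bcontfun d x) \<le> 1"
        using mult_mono[OF t order_trans[OF norm_bounded[of d x] d(2)]] by (simp add: norm_mult)
      ultimately show "cmod (apply_bcontfun (c d) x) \<le> 2"
        unfolding c_def using norm_triangle_ineq4[of "t * apply_bcontfun d x" "apply_bcontfun (T d) y"]
        by simp
    qed
    have "c d = const_bcontfun t * d + const_bcontfun (- apply_bcontfun (T d) y) * 1"
      unfolding c_def by (rule bcontfun_eqI) simp
    also have "T \<dots> = const_bcontfun t * T d + const_bcontfun (- apply_bcontfun (T d) y) * T 1"
      using d(1) one by (simp only: T_add T_scale uniform_algebra_mult[OF ua] uniform_algebra_const[OF ua])
    finally show "apply_bcontfun (T (c d)) y = 0" by (simp add: t_def)
  qed
  \<comment> \<open>One point \<open>x\<close> serves both test elements. This is where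
    multiplicativity enters: the values of \<open>b\<close> and \<open>b * b\<close> at
    \<open>x\<close> are \<open>u\<close> and \<open>u * u\<close>.\<close>
  obtain x where x: "\<And>d. d \<in> {c b, c (b * b)} \<Longrightarrow>
      cmod (apply_bcontfun d x) \<le> cmod (apply_bcontfun (T d) y) + 3 * \<epsilon> * 2"
    using exists_dominated_point[OF y, of "{c b, c (b * b)}" 2] c[OF b] c[OF bb] by auto
  define u where "u = apply_bcontfun b x"
  define v where "v = apply_bcontfun (T b) y"
  define w where "w = apply_bcontfun (T (b * b)) y"
  have 1: "cmod (t * u - v) \<le> 6 * \<epsilon>" and 2: "cmod (t * (u * u) - w) \<le> 6 * \<epsilon>"
    using x[of "c b"] x[of "c (b * b)"] c(3)[OF b] c(3)[OF bb]
    by (auto simp: c_def u_def v_def w_def)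
  have "cmod u \<le> 1" "cmod v \<le> 1"
    using norm_bounded[of b x] norm_bounded[of "T b" y] contr[OF b(1)] b(2)
    unfolding u_def v_def by linarith+
  with t have 3: "cmod (t * u + v) \<le> 2"
    using norm_triangle_ineq[of "t * u" v] mult_mono[OF t \<open>cmod u \<le> 1\<close>] by (simp add: norm_mult)
  \<comment> \<open>Eliminating \<open>u\<close> between the two approximate relations costs
    \<open>6 * \<epsilon> * 2\<close> for the first and \<open>6 * \<epsilon>\<close> for the
    second.\<close>
  have "t * w - v\<^sup>2 = (t * u - v) * (t * u + v) - t * (t * (u * u) - w)"
    by (simp add: algebra_simps power2_eq_square)
  also have "cmod \<dots> \<le> cmod (t * u - v) * cmod (t * u + v) + cmod t * cmod (t * (u * u) - w)"
    by (metis norm_mult norm_triangle_ineq4)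
  also have "\<dots> \<le> 6 * \<epsilon> * 2 + 1 * (6 * \<epsilon>)"
    using 1 2 3 t \<epsilon> by (intro add_mono mult_mono) auto
  finally show ?thesis by (simp add: t_def v_def w_def)
qed

text \<open>The left-hand expression is homogeneous of degree two in \<open>b\<close>, hence the
  factor \<open>K\<^sup>2\<close>.\<close>

lemma T_one_mult_T_square_scaled:
  assumes y: "y \<in> peaking_points A" and b: "b \<in> A" "norm b \<le> K" and "0 < K"
  shows "cmod (apply_bcontfun (T 1) y * apply_bcontfun (T (b * b)) y - (apply_bcontfun (T b) y)\<^sup>2)
    \<le> 18 * \<epsilon> * K\<^sup>2"
proof -
  define s :: complex where "s = of_real (inverse K)"
  have s: "cmod s * K = 1" using \<open>0 < K\<close> by (simp add: s_def norm_inverse)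
  define d where "d = const_bcontfun s * b"
  have d: "d \<in> A" unfolding d_def using b
    by (intro uniform_algebra_mult[OF ua] uniform_algebra_const[OF ua])
  have "norm d \<le> cmod s * K"
    unfolding d_def norm_const_bcontfun_mult using b(2) by (intro mult_left_mono) auto
  with s have "norm d \<le> 1" by simp
  note * = T_one_mult_T_square[OF y d this]
  have "d * d = const_bcontfun (s * s) * (b * b)"
    unfolding d_def by (rule bcontfun_eqI) simp
  then have "T (d * d) = const_bcontfun (s * s) * T (b * b)"
    using uniform_algebra_mult[OF ua b(1) b(1)] by (simp only: T_scale)
  moreover have "T d = const_bcontfun s * T b" unfolding d_def using b(1) by (rule T_scale)
  ultimately have "apply_bcontfun (T 1) y * apply_bcontfun (T (d * d)) y - (apply_bcontfun (T d) y)\<^sup>2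
      = s * s * (apply_bcontfun (T 1) y * apply_bcontfun (T (b * b)) y - (apply_bcontfun (T b) y)\<^sup>2)"
    (is "_ = s * s * ?D") by (simp add: power2_eq_square algebra_simps)
  with * have **: "cmod s * cmod s * cmod ?D \<le> 18 * \<epsilon>" by (simp add: norm_mult)
  have "cmod ?D = (cmod s * cmod s * cmod ?D) * K\<^sup>2"
    using s by (simp add: power2_eq_square) (metis (no_types, opaque_lifting) mult.assoc mult.commute mult_1)
  also have "\<dots> \<le> 18 * \<epsilon> * K\<^sup>2" using ** by (intro mult_right_mono) auto
  finally show ?thesis .
qed

text \<open>With \<open>T b = f\<close> and \<open>T (b * b) = k * f\<close>, the quadratic relation
  makes \<open>(h * k - 1) * f\<^sup>2\<close> small at peaking points. As
  \<open>\<bar>f\<bar> \<ge> m\<close> and peaking points form a boundary, \<open>h * k\<close> is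
  within distance less than 1 of \<open>1\<close>, so it is invertible, and so is its factor
  \<open>h\<close>.\<close>

lemma T_one_eq_invertible_mult:
  assumes m: "0 < m" "\<And>x. m \<le> cmod (apply_bcontfun f x)"
    and small: "\<epsilon> \<le> 1" "72 * \<epsilon> * (norm f)\<^sup>2 < m\<^sup>2"
  obtains h where "h \<in> invertibles A" "T 1 = h * f"
proof -
  have T_in: "T a \<in> principal_module A f" if "a \<in> A" for a using im that by blast
  have one: "1 \<in> A" by (rule uniform_algebra_one[OF ua])
  obtain h where h: "h \<in> A" "T 1 = h * f" using T_in[OF one] by (auto simp: principal_module_def)
  have "1 * f \<in> T ` A" unfolding im principal_module_def using one by blast
  then obtain b where b: "b \<in> A" "T b = f" by auto
  obtain k where k: "k \<in> A" "T (b * b) = k * f"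
    using T_in[OF uniform_algebra_mult[OF ua b(1) b(1)]] by (auto simp: principal_module_def)
  have f0: "0 < norm f" using m(1) m(2)[of undefined] norm_bounded[of f undefined] by linarith
  have "norm b \<le> (1 + \<epsilon>) * norm f" using expand[OF b(1)] b(2) by simp
  also have "\<dots> \<le> 2 * norm f" using small(1) by (intro mult_right_mono) auto
  finally have nb: "norm b \<le> 2 * norm f" .
  \<comment> \<open>The bound \<open>2 * norm f\<close> for \<open>b\<close> turns the constant 18
    into \<open>18 * 4 = 72\<close>; the denominator comes from
    \<open>\<bar>f\<bar> \<ge> m\<close>.\<close>
  define r where "r = 72 * \<epsilon> * (norm f)\<^sup>2 / m\<^sup>2"
  have "cmod (apply_bcontfun (1 - h * k) y) \<le> r" if y: "y \<in> peaking_points A" for y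
  proof -
    let ?d = "apply_bcontfun (1 - h * k) y" and ?f = "apply_bcontfun f y"
    have "cmod ?d * (cmod ?f)\<^sup>2 = cmod (- (?d * ?f\<^sup>2))" by (simp add: norm_mult norm_power)
    also have "- (?d * ?f\<^sup>2) = apply_bcontfun (T 1) y * apply_bcontfun (T (b * b)) y - (apply_bcontfun (T b) y)\<^sup>2"
      by (simp add: h k b algebra_simps power2_eq_square)
    also have "cmod \<dots> \<le> 18 * \<epsilon> * (2 * norm f)\<^sup>2"
      using f0 by (intro T_one_mult_T_square_scaled[OF y b(1) nb]) simp
    finally have "cmod ?d * (cmod ?f)\<^sup>2 \<le> 72 * \<epsilon> * (norm f)\<^sup>2" by (simp add: power_mult_distrib)
    moreover have "cmod ?d * m\<^sup>2 \<le> cmod ?d * (cmod ?f)\<^sup>2"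
      using m by (intro mult_left_mono power_mono) auto
    ultimately show ?thesis using m(1) by (simp add: r_def pos_le_divide_eq)
  qed
  moreover have hk: "h * k \<in> A" using h k by (intro uniform_algebra_mult[OF ua])
  ultimately have "norm (1 - h * k) \<le> r"
    using one by (intro norm_le_if_le_on_peaking[OF cpt ua] uniform_algebra_diff[OF ua])
  also have "r < 1" using small(2) m(1) by (simp add: r_def)
  finally have "h * k \<in> invertibles A" by (intro invertibles_near_one[OF ua cpt hk])
  with h k show thesis by (intro that[of h] invertibles_cancel_right[OF ua, of h k])
qed

end

section \<open>Implications between the three conditions\<close>

context
  fixes A :: "('a::t2_space \<Rightarrow>\<^sub>C complex) set" and f :: "'a \<Rightarrow>\<^sub>C complex"
  assumes cpt: "compact (UNIV :: 'a set)" and ua: "uniform_algebra A"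
    and pos: "strictly_positive f"
begin

text \<open>The product \<open>h * f\<close> is \<open>T 1\<close> for a normalised almost isometry
  \<open>T\<close>: contraction gives the upper bound everywhere, domination the lower bound at
  peaking points.\<close>

lemma almost_isometric_imp_invertible_multiplier:
  assumes "almost_isometric A (principal_module A f)" "0 < \<delta>"
  obtains h where "h \<in> invertibles A" "\<And>x. cmod (apply_bcontfun (h * f) x) \<le> 1"
    "\<And>y. y \<in> peaking_points A \<Longrightarrow> 1 - \<delta> \<le> cmod (apply_bcontfun (h * f) y)"
proof -
  have f: "\<And>x. apply_bcontfun f x \<noteq> 0" using pos by (rule strictly_positive_nonzero)
  obtain m where m: "0 < m" "\<And>x. m \<le> cmod (apply_bcontfun f x)"
    using bcontfun_bounded_below[OF cpt f] by blast
  have f0: "0 < norm f" using m(1) m(2)[of undefined] norm_bounded[of f undefined] by linarith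
  \<comment> \<open>The term \<open>\<delta> / 3\<close> absorbs the loss
    \<open>3 * \<epsilon>\<close> in the lower bound; 73 in place of 72 makes the smallness
    condition strict.\<close>
  define \<epsilon> where "\<epsilon> = min (min 1 (\<delta> / 3)) (m\<^sup>2 / (73 * (norm f)\<^sup>2))"
  have "0 < m\<^sup>2 / (73 * (norm f)\<^sup>2)" using m f0 by (intro divide_pos_pos) auto
  then have \<epsilon>: "0 < \<epsilon>" "\<epsilon> \<le> 1" "3 * \<epsilon> \<le> \<delta>" using assms(2) by (auto simp: \<epsilon>_def)
  have "\<epsilon> \<le> m\<^sup>2 / (73 * (norm f)\<^sup>2)" by (simp add: \<epsilon>_def)
  then have "73 * \<epsilon> * (norm f)\<^sup>2 \<le> m\<^sup>2" using f0 by (simp add: field_simps)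
  moreover have "72 * \<epsilon> * (norm f)\<^sup>2 < 73 * \<epsilon> * (norm f)\<^sup>2" using \<epsilon>(1) f0 by simp
  ultimately have small: "72 * \<epsilon> * (norm f)\<^sup>2 < m\<^sup>2" by linarith
  obtain T where T: "complex_linear_on A T" "T ` A = principal_module A f"
    "\<And>a. a \<in> A \<Longrightarrow> norm (T a) \<le> norm a"
    "\<And>a. a \<in> A \<Longrightarrow> norm a \<le> (1 + \<epsilon>) * norm (T a)"
    using almost_isometric_imp_normalized[OF ua assms(1) \<epsilon>(1)] by metis
  note facts = cpt ua f T \<epsilon>(1)
  obtain h where h: "h \<in> invertibles A" "T 1 = h * f"
    using T_one_eq_invertible_mult[OF facts m \<epsilon>(2) small] by blast
  show thesis
  proof (rule that[OF h(1)])
    show "cmod (apply_bcontfun (h * f) x) \<le> 1" for x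
      unfolding h(2)[symmetric] by (rule cmod_T_one_le[OF facts])
    show "1 - \<delta> \<le> cmod (apply_bcontfun (h * f) y)" if "y \<in> peaking_points A" for y
      unfolding h(2)[symmetric] using cmod_T_one_ge[OF facts that] \<epsilon>(3) by simp
  qed
qed

text \<open>Each \<open>a\<close> in \<open>A\<close> attains its norm at a peaking point, where
  \<open>\<bar>h * f\<bar> \<ge> 1 - \<delta>\<close>. This gives the lower norm estimate for the
  multiplier \<open>h\<close>.\<close>

lemma almost_isometric_imp_almost_module_isometric:
  assumes "almost_isometric A (principal_module A f)"
  shows "almost_module_isometric A A (principal_module A f)"
proof (rule almost_module_isometricI[OF ua])
  fix \<delta> :: real assume "0 < \<delta>" "\<delta> < 1"
  obtain h where h: "h \<in> invertibles A" "\<And>x. cmod (apply_bcontfun (h * f) x) \<le> 1"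
    "\<And>y. y \<in> peaking_points A \<Longrightarrow> 1 - \<delta> \<le> cmod (apply_bcontfun (h * f) y)"
    using almost_isometric_imp_invertible_multiplier[OF assms \<open>0 < \<delta>\<close>] by metis
  have "(1 - \<delta>) * norm a \<le> norm (a * h * f) \<and> norm (a * h * f) \<le> (1 + \<delta>) * norm a"
    if a: "a \<in> A" for a
  proof
    have "norm (a * (h * f)) \<le> norm a * norm (h * f)" by (rule norm_mult_bcontfun_le)
    also have "\<dots> \<le> norm a * (1 + \<delta>)"
      using norm_bound[of "h * f", OF h(2)] \<open>0 < \<delta>\<close> by (intro mult_left_mono) auto
    finally show "norm (a * h * f) \<le> (1 + \<delta>) * norm a" by (simp add: mult_ac)
    obtain y where y: "y \<in> peaking_points A" "cmod (apply_bcontfun a y) = norm a"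
      using is_boundary_peaking_points[OF cpt ua] a unfolding is_boundary_def by blast
    have "(1 - \<delta>) * norm a \<le> cmod (apply_bcontfun (h * f) y) * cmod (apply_bcontfun a y)"
      unfolding y(2) by (intro mult_right_mono h(3) y) auto
    also have "\<dots> = cmod (apply_bcontfun (a * h * f) y)" by (simp add: norm_mult)
    also have "\<dots> \<le> norm (a * h * f)" by (rule norm_bounded)
    finally show "(1 - \<delta>) * norm a \<le> norm (a * h * f)" .
  qed
  with h(1) show "\<exists>h\<in>invertibles A. \<forall>a\<in>A.
      (1 - \<delta>) * norm a \<le> norm (a * h * f) \<and> norm (a * h * f) \<le> (1 + \<delta>) * norm a"
    by blast
qed

text \<open>If \<open>\<bar>g\<bar>\<close> is uniformly close to \<open>f\<close>, which is bounded
  away from 0, then \<open>f / \<bar>g\<bar>\<close> is uniformly close to 1. The multiplier is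
  therefore the inverse \<open>k\<close> of \<open>g\<close>.\<close>

lemma Q_closure_pos_imp_almost_module_isometric:
  assumes "f \<in> Q_closure_pos A"
  shows "almost_module_isometric A A (principal_module A f)"
proof (rule almost_module_isometricI[OF ua])
  fix \<delta> :: real assume \<delta>: "0 < \<delta>" "\<delta> < 1"
  obtain m where m: "0 < m" "\<And>x. m \<le> cmod (apply_bcontfun f x)"
    using bcontfun_bounded_below[OF cpt strictly_positive_nonzero[OF pos]] by metis
  \<comment> \<open>As \<open>\<delta> < 1\<close>, this gives
    \<open>e \<le> \<delta> * (m - e)\<close>. Since \<open>\<bar>g\<bar> \<ge> m - e\<close>, the
    absolute error \<open>e\<close> becomes a relative error at most
    \<open>\<delta>\<close>.\<close>
  define e where "e = m * \<delta> / 2"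
  have e: "0 < e" "e + e \<le> m * \<delta>" using m \<delta> by (auto simp: e_def)
  have "m * \<delta> < m * 1" using m \<delta> by (intro mult_strict_left_mono) auto
  with e have "e < m" by linarith
  from assms e(1) obtain g where g: "g \<in> invertibles A" "dist (modulus g) f < e"
    unfolding Q_closure_pos_def Q_set_def closure_approachable by blast
  then obtain k where k: "g \<in> A" "k \<in> A" "g * k = 1" by (auto simp: invertibles_def)
  have kinv: "k \<in> invertibles A" using k by (auto simp: invertibles_def mult.commute)
  have near: "1 - \<delta> \<le> cmod (apply_bcontfun (k * f) x) \<and> cmod (apply_bcontfun (k * f) x) \<le> 1 + \<delta>" for x
  proof -
    define G where "G = cmod (apply_bcontfun g x)"
    define F where "F = cmod (apply_bcontfun f x)"
    have "dist (apply_bcontfun (modulus g) x) (apply_bcontfun f x) < e"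
      using dist_bounded g(2) by (rule le_less_trans)
    moreover have "dist (apply_bcontfun (modulus g) x) (apply_bcontfun f x) = \<bar>G - F\<bar>"
      by (subst strictly_positive_eq_cmod[OF pos])
        (simp add: dist_norm G_def F_def modulus.rep_eq flip: of_real_diff)
    ultimately have GF: "\<bar>G - F\<bar> < e" by simp
    have "apply_bcontfun g x * apply_bcontfun k x = 1"
      using k(3) by (metis one_bcontfun.rep_eq times_bcontfun.rep_eq)
    then have Gk: "G * cmod (apply_bcontfun k x) = 1" unfolding G_def by (metis norm_mult norm_one)
    have "m \<le> F" using m(2) by (simp add: F_def)
    have "\<bar>G - F\<bar> \<le> \<delta> * G"
    proof -
      have "e * (1 + \<delta>) \<le> e * 2" using e(1) \<delta> by (intro mult_left_mono) auto
      also have "\<dots> \<le> \<delta> * m" using e(2) by (simp add: mult.commute)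
      finally have "e \<le> \<delta> * (m - e)" by (simp add: algebra_simps)
      also have "\<dots> \<le> \<delta> * G" using GF \<open>m \<le> F\<close> \<delta> by (intro mult_left_mono) auto
      finally show ?thesis using GF by simp
    qed
    moreover have "0 < G" using GF \<open>m \<le> F\<close> \<open>e < m\<close> by linarith
    moreover have kf: "cmod (apply_bcontfun (k * f) x) = F / G"
      using Gk \<open>0 < G\<close> by (simp add: norm_mult F_def field_simps)
    ultimately show ?thesis unfolding kf
      by (simp only: pos_le_divide_eq pos_divide_le_eq) (simp add: abs_le_iff algebra_simps)
  qed
  have "(1 - \<delta>) * norm a \<le> norm (a * k * f) \<and> norm (a * k * f) \<le> (1 + \<delta>) * norm a" for a
  proof
    have "norm (a * (k * f)) \<le> norm a * norm (k * f)" by (rule norm_mult_bcontfun_le)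
    also have "\<dots> \<le> norm a * (1 + \<delta>)"
      using norm_bound[of "k * f" "1 + \<delta>"] near by (intro mult_left_mono) auto
    finally show "norm (a * k * f) \<le> (1 + \<delta>) * norm a" by (simp add: mult_ac)
    obtain y where y: "cmod (apply_bcontfun a y) = norm a"
      using norm_bcontfun_attained[OF cpt] by blast
    have "(1 - \<delta>) * norm a \<le> cmod (apply_bcontfun (k * f) y) * cmod (apply_bcontfun a y)"
      unfolding y using near by (intro mult_right_mono) auto
    also have "\<dots> = cmod (apply_bcontfun (a * k * f) y)" by (simp add: norm_mult)
    also have "\<dots> \<le> norm (a * k * f)" by (rule norm_bounded)
    finally show "(1 - \<delta>) * norm a \<le> norm (a * k * f)" .
  qed
  with kinv show "\<exists>h\<in>invertibles A. \<forall>a\<in>A.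
      (1 - \<delta>) * norm a \<le> norm (a * h * f) \<and> norm (a * h * f) \<le> (1 + \<delta>) * norm a"
    by blast
qed

text \<open>All points are peaking here, so
  \<open>1 - \<delta> \<le> \<bar>h * f\<bar> \<le> 1\<close> everywhere. For the inverse
  \<open>g\<close> of \<open>h\<close> this says
  \<open>(1 - \<delta>) * \<bar>g\<bar> \<le> f \<le> \<bar>g\<bar>\<close>.\<close>

lemma almost_isometric_imp_Q_closure_pos:
  assumes "is_Shilov_boundary A UNIV" "almost_isometric A (principal_module A f)"
  shows "f \<in> Q_closure_pos A"
proof -
  have peak: "y \<in> peaking_points A" for y
    using Shilov_boundary_UNIV_imp_peaking[OF cpt ua assms(1)] by simp
  have "f \<in> closure (Q_set A)"
    unfolding closure_approachable
  proof (intro allI impI)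
    fix e :: real assume "0 < e"
    \<comment> \<open>The bound \<open>1 / 2\<close> yields
      \<open>\<bar>g\<bar> \<le> 2 * f\<close>, so the distance is at most
      \<open>2 * \<delta> * norm f\<close>; the second term brings this strictly below
      \<open>e\<close>, also when \<open>norm f\<close> is small.\<close>
    define \<delta> where "\<delta> = min (1 / 2) (e / (3 * (norm f + 1)))"
    have f3: "0 < 3 * (norm f + 1)" by (simp add: add_nonneg_pos)
    then have \<delta>: "0 < \<delta>" "\<delta> \<le> 1 / 2" using \<open>0 < e\<close> unfolding \<delta>_def by (simp, intro min.cobounded1)
    have "\<delta> \<le> e / (3 * (norm f + 1))" by (simp add: \<delta>_def)
    then have \<delta>_e: "\<delta> * (3 * (norm f + 1)) \<le> e" using f3 by (simp only: pos_le_divide_eq)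
    obtain h where h: "h \<in> invertibles A" "\<And>x. cmod (apply_bcontfun (h * f) x) \<le> 1"
      "\<And>y. 1 - \<delta> \<le> cmod (apply_bcontfun (h * f) y)"
      using almost_isometric_imp_invertible_multiplier[OF assms(2) \<delta>(1)] peak by metis
    then obtain g where g: "h \<in> A" "g \<in> A" "h * g = 1" by (auto simp: invertibles_def)
    then have "g \<in> invertibles A" by (auto simp: invertibles_def mult.commute)
    then have "modulus g \<in> Q_set A" by (auto simp: Q_set_def)
    moreover have "dist (modulus g) f \<le> 2 * \<delta> * norm f"
    proof (rule dist_bound)
      fix x
      define G where "G = cmod (apply_bcontfun g x)"
      define H where "H = cmod (apply_bcontfun h x)"
      define F where "F = cmod (apply_bcontfun f x)"
      have "apply_bcontfun h x * apply_bcontfun g x = 1"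
        using g(3) by (metis one_bcontfun.rep_eq times_bcontfun.rep_eq)
      then have HG: "H * G = 1" unfolding G_def H_def by (metis norm_mult norm_one)
      have HF: "H * F \<le> 1" "1 - \<delta> \<le> H * F"
        using h(2)[of x] h(3)[of x] by (auto simp: H_def F_def norm_mult)
      have nn: "0 \<le> G" "0 \<le> F" by (auto simp: G_def F_def)
      have "G * (H * F) \<le> G * 1" "G * (1 - \<delta>) \<le> G * (H * F)"
        by (rule mult_left_mono[OF HF(1) nn(1)], rule mult_left_mono[OF HF(2) nn(1)])
      moreover have "G * (H * F) = F" using HG by (metis mult.assoc mult.commute mult_1)
      ultimately have *: "F \<le> G" "G * (1 - \<delta>) \<le> F" by simp_all
      have "G * (1 / 2) \<le> G * (1 - \<delta>)" using nn \<delta>(2) by (intro mult_left_mono) auto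
      with * have "G \<le> 2 * F" by simp
      then have "\<delta> * G \<le> \<delta> * (2 * F)" using \<delta>(1) by (intro mult_left_mono) auto
      moreover have "\<delta> * (2 * F) \<le> \<delta> * (2 * norm f)"
        using \<delta>(1) norm_bounded[of f x] by (intro mult_left_mono) (auto simp: F_def)
      ultimately have "\<bar>G - F\<bar> \<le> 2 * \<delta> * norm f" using * by (simp add: algebra_simps)
      moreover have "dist (apply_bcontfun (modulus g) x) (apply_bcontfun f x) = \<bar>G - F\<bar>"
        by (subst strictly_positive_eq_cmod[OF pos])
          (simp add: dist_norm G_def F_def modulus.rep_eq flip: of_real_diff)
      ultimately show "dist (apply_bcontfun (modulus g) x) (apply_bcontfun f x) \<le> 2 * \<delta> * norm f"
        by simp
    qed
    moreover have "2 * \<delta> * norm f < \<delta> * (3 * (norm f + 1))"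
    proof -
      have "2 * t < 3 * (t + 1)" if "0 \<le> t" for t :: real using that by simp
      from mult_strict_left_mono[OF this[OF norm_ge_zero] \<delta>(1)]
      show ?thesis by (simp only: mult_ac)
    qed
    ultimately show "\<exists>g\<in>Q_set A. dist g f < e"
      using \<delta>_e by (intro bexI[of _ "modulus g"]) auto
  qed
  with pos show ?thesis by (simp add: Q_closure_pos_def)
qed

end

theorem corollary4p2:
  fixes A :: "('a::t2_space \<Rightarrow>\<^sub>C complex) set" and f :: "'a \<Rightarrow>\<^sub>C complex"
  assumes "compact (UNIV :: 'a set)"
    and "uniform_algebra A"
    and "strictly_positive f"
  shows "(almost_module_isometric A A (principal_module A f) \<longleftrightarrow>
            almost_isometric A (principal_module A f)) \<and>
         (is_Shilov_boundary A UNIV \<longrightarrow>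
            (almost_module_isometric A A (principal_module A f) \<longleftrightarrow> f \<in> Q_closure_pos A) \<and>
            (almost_isometric A (principal_module A f) \<longleftrightarrow> f \<in> Q_closure_pos A))"
  using almost_isometric_imp_almost_module_isometric[OF assms]
    almost_module_isometric_imp_almost_isometric[of A A "principal_module A f"]
    Q_closure_pos_imp_almost_module_isometric[OF assms]
    almost_isometric_imp_Q_closure_pos[OF assms]
  by blast

end
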